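(* For every prime power $q$, the power graph of $\mathrm{PSp}(4,q)$ is not a chordal graph.
   Context: The power graph $\mathcal{P}(G)$ of a group $G$ is the undirected simple graph with vertex set $G$ in which distinct $a,b$ are adjacent iff $a=b^m$ or $b=a^n$ for some positive integers $m,n$. A graph is chordal if it has no induced cycle of length $4$ or more. $\mathrm{PSp}(4,q)$ is the projective symplectic group of degree $4$ over $GF(q)$. *)

theory Defs
  imports
    "HOL-Analysis.Cartesian_Space"
    "HOL-Algebra.Coset"
    "HOL-Number_Theory.Prime_Powers"
begin

text \<open>A simple graph is a pair of its vertex set and its edge set, edges being two-element sets.\<close>

type_synonym 'a sgraph = "'a set \<times> 'a set set"

text \<open>The vertices \<open>c 0, \<dots>, c (n - 1)\<close>, in this cyclic order, induce a cycle of length \<open>n\<close>;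
  meaningful for \<open>n \<ge> 3\<close>.\<close>

definition induced_cycle :: "'a sgraph \<Rightarrow> nat \<Rightarrow> (nat \<Rightarrow> 'a) \<Rightarrow> bool" where
  "induced_cycle \<Gamma> n c \<longleftrightarrow>
     inj_on c {..<n} \<and> c ` {..<n} \<subseteq> fst \<Gamma> \<and>
     (\<forall>i<n. \<forall>j<n. {c i, c j} \<in> snd \<Gamma> \<longleftrightarrow> j = Suc i mod n \<or> i = Suc j mod n)"

definition chordal :: "'a sgraph \<Rightarrow> bool" where
  "chordal \<Gamma> \<longleftrightarrow> \<not> (\<exists>n c. n \<ge> 4 \<and> induced_cycle \<Gamma> n c)"

definition power_graph :: "('a, 'b) monoid_scheme \<Rightarrow> 'a sgraph" where
  "power_graph G =
     (carrier G,
      {{a, b} | a b. a \<in> carrier G \<and> b \<in> carrier G \<and> a \<noteq> b \<and>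
         ((\<exists>m::nat. m > 0 \<and> a = b [^]\<^bsub>G\<^esub> m) \<or> (\<exists>n::nat. n > 0 \<and> b = a [^]\<^bsub>G\<^esub> n))})"

definition group_centre :: "('a, 'b) monoid_scheme \<Rightarrow> 'a set" where
  "group_centre G = {z \<in> carrier G. \<forall>x\<in>carrier G. z \<otimes>\<^bsub>G\<^esub> x = x \<otimes>\<^bsub>G\<^esub> z}"

text \<open>The Gram matrix of the standard symplectic form. It has zero diagonal, so the form is
  alternating in characteristic 2 as well.\<close>

definition sympl_form :: "'a::field ^ 4 ^ 4" where
  "sympl_form = vector
     [vector [ 0,  0, 1, 0],
      vector [ 0,  0, 0, 1],
      vector [-1,  0, 0, 0],
      vector [ 0, -1, 0, 0]]"

definition Sp4 :: "('a::field ^ 4 ^ 4) monoid" where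
  "Sp4 = \<lparr>carrier = {A. transpose A ** sympl_form ** A = sympl_form}, monoid.mult = (**), one = mat 1\<rparr>"

definition PSp4 :: "('a::field ^ 4 ^ 4) set monoid" where
  "PSp4 = Sp4 Mod group_centre Sp4"

lemma sympl_form_square: "sympl_form ** sympl_form = - (mat 1 :: 'a::field ^ 4 ^ 4)"
  by (simp add: vec_eq_iff forall_4 matrix_matrix_mult_def sum_4 sympl_form_def vector_def mat_def)

lemma neg_matrix_mult: "(- A) ** B = - (A ** B :: 'a::field ^ 4 ^ 4)"
  by (simp add: vec_eq_iff matrix_matrix_mult_def sum_negf)

lemma group_Sp4: "group (Sp4 :: ('a::field ^ 4 ^ 4) monoid)"
proof (rule groupI)
  let ?J = "sympl_form :: 'a ^ 4 ^ 4"
  fix A B C :: "'a ^ 4 ^ 4"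
  show "A \<otimes>\<^bsub>Sp4\<^esub> B \<in> carrier Sp4" if "A \<in> carrier Sp4" "B \<in> carrier Sp4"
  proof -
    have "transpose (A ** B) ** ?J ** (A ** B) = transpose B ** (transpose A ** ?J ** A) ** B"
      by (simp add: matrix_transpose_mul matrix_mul_assoc)
    then show ?thesis using that by (simp add: Sp4_def)
  qed
  show "\<exists>B\<in>carrier Sp4. B \<otimes>\<^bsub>Sp4\<^esub> A = \<one>\<^bsub>Sp4\<^esub>" if "A \<in> carrier Sp4"
  proof -
    have A: "transpose A ** ?J ** A = ?J" using that by (simp add: Sp4_def)
    define B where "B = - ?J ** transpose A ** ?J"
    have "B ** A = - (?J ** (transpose A ** ?J ** A))"
      by (simp add: B_def neg_matrix_mult matrix_mul_assoc)
    then have BA: "B ** A = mat 1" by (simp add: A sympl_form_square)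
    then have AB: "A ** B = mat 1" using matrix_left_right_inverse by blast
    have "transpose B ** ?J ** B = transpose B ** (transpose A ** ?J ** A) ** B" by (simp add: A)
    also have "\<dots> = transpose (A ** B) ** ?J ** (A ** B)"
      by (simp add: matrix_transpose_mul matrix_mul_assoc)
    finally show ?thesis using BA by (auto simp: AB Sp4_def transpose_mat)
  qed
qed (auto simp: Sp4_def transpose_mat matrix_mul_assoc)

lemma (in group) group_centre_normal: "group_centre G \<lhd> G"
proof (rule normal_invI)
  show "subgroup (group_centre G) G"
  proof (rule subgroupI)
    show "inv z \<in> group_centre G" if "z \<in> group_centre G" for z
    proof -
      have z: "z \<in> carrier G" "\<And>x. x \<in> carrier G \<Longrightarrow> z \<otimes> x = x \<otimes> z"
        using that by (auto simp: group_centre_def)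
      have "inv z \<otimes> x = x \<otimes> inv z" if x: "x \<in> carrier G" for x
        using z(2)[OF inv_closed[OF x]] z(1) x by (metis inv_closed inv_inv inv_mult_group)
      then show ?thesis using z(1) by (simp add: group_centre_def)
    qed
    show "y \<otimes> z \<in> group_centre G" if "y \<in> group_centre G" "z \<in> group_centre G" for y z
    proof -
      have "y \<otimes> z \<otimes> x = x \<otimes> (y \<otimes> z)" if x: "x \<in> carrier G" for x
      proof -
        have c: "y \<in> carrier G" "z \<in> carrier G" "y \<otimes> x = x \<otimes> y" "z \<otimes> x = x \<otimes> z"
          using \<open>y \<in> _\<close> \<open>z \<in> _\<close> x by (auto simp: group_centre_def)
        have "y \<otimes> z \<otimes> x = y \<otimes> (x \<otimes> z)" using c x by (simp add: m_assoc)
        also have "\<dots> = x \<otimes> y \<otimes> z" using c x by (simp add: m_assoc[symmetric])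
        finally show ?thesis using c x by (simp add: m_assoc)
      qed
      with that show ?thesis unfolding group_centre_def using m_closed by blast
    qed
  qed (auto simp: group_centre_def)
  show "x \<otimes> h \<otimes> inv x \<in> group_centre G" if "x \<in> carrier G" "h \<in> group_centre G" for x h
  proof -
    have "x \<otimes> h \<otimes> inv x = h"
    proof -
      have c: "h \<in> carrier G" "x \<otimes> h = h \<otimes> x"
        using that by (auto simp: group_centre_def)
      then show ?thesis using that(1) by (simp add: m_assoc)
    qed
    then show ?thesis using that by simp
  qed
qed

lemma group_PSp4: "group (PSp4 :: ('a::field ^ 4 ^ 4) set monoid)"
  unfolding PSp4_def
  by (rule normal.factorgroup_is_group[OF group.group_centre_normal[OF group_Sp4]])

end

theory Submission
  imports Defs
begin

text \<open>
  In a power graph, two commuting elements \<open>x\<close>, \<open>y\<close> of coprime orders are joined by the path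
  \<open>x\<close>, \<open>x y\<close>, \<open>y\<close>, because both are powers of their product. So a closed walk
  \<open>w\<^sub>0, \<dots>, w\<^sub>N\<^sub>-\<^sub>1\<close> of elements in which neighbours commute and the orders divide alternately
  \<open>m\<close> and \<open>k\<close>, with \<open>m\<close> and \<open>k\<close> coprime, yields a closed walk of length \<open>2 N\<close> in the power
  graph. It is an induced cycle as soon as no \<open>w\<^sub>i\<close> is a power of another \<open>w\<^sub>j\<close> of the same
  parity (\<open>induced_cycle_power_graph\<close>).

  In a quotient by the centre the last condition is easy to guarantee: if \<open>x\<close> is a power of \<open>y\<close>
  modulo the centre, then \<open>x\<close> commutes with \<open>y\<close>. It is therefore enough to find, in \<open>Sp(4, q)\<close>
  itself, a closed walk in which distinct elements of the same parity do not commute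
  (\<open>not_chordal_Mod_centre\<close>), and the centre never has to be computed.

  If \<open>q\<close> is odd, such a walk of length four lies in the subgroup
  \<open>SL(2, q) \<times> SL(2, q)\<close> of \<open>Sp(4, q)\<close>: two noncommuting elements of order four in the
  first factor alternate with two noncommuting elements of order \<open>p\<close>, the characteristic, in the
  second one. This gives an induced cycle of length eight.

  If \<open>q\<close> is even, the walk has length six and lies in \<open>Sp(4, 2)\<close>, which is the symmetric group
  on six letters. For \<open>q = 2\<close> a walk of length four as above is impossible, since \<open>SL(2, 2)\<close> has
  only one subgroup of order three. Instead the transpositions
  \<open>(1 2), (1 3), (1 4)\<close> alternate with three-cycles on \<open>{4, 5, 6}, {2, 5, 6}, {3, 5, 6}\<close>. In
  \<open>Sp(4, 2)\<close> these are matrices with entries \<open>0\<close> and \<open>1\<close>, which have the same multiplicative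
  relations over every field of characteristic two. This gives an induced cycle of length twelve.
\<close>

section \<open>Cycles in power graphs\<close>

text \<open>
  The vertices of the cycle are \<open>w\<^sub>0, w\<^sub>0 w\<^sub>1, w\<^sub>1, w\<^sub>1 w\<^sub>2, \<dots>\<close>. The label of the \<open>v\<close>-th one is the
  set of the indices of its factors; for even \<open>v\<close> the two indices below coincide. Being a power of
  a vertex will turn out to be inclusion of labels.
\<close>

definition cycle_label :: "nat \<Rightarrow> nat \<Rightarrow> nat set" where
  "cycle_label N v = {v div 2, (Suc v div 2) mod N}"

lemma cycle_label_even: "i < N \<Longrightarrow> cycle_label N (2 * i) = {i}"
  by (simp add: cycle_label_def)

lemma cycle_label_odd: "cycle_label N (Suc (2 * i)) = {i, Suc i mod N}"
  by (simp add: cycle_label_def)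

lemma nat_less_double_cases:
  fixes v N :: nat
  assumes "v < 2 * N"
  obtains (even) i where "i < N" "v = 2 * i" | (odd) i where "i < N" "v = Suc (2 * i)"
proof (cases "even v")
  case True
  then obtain i where "v = 2 * i" by (elim evenE)
  with assms show ?thesis by (intro even) auto
next
  case False
  then obtain i where "v = Suc (2 * i)" by (auto elim: oddE)
  with assms show ?thesis by (intro odd) auto
qed

lemma cycle_label_inj:
  assumes "N \<ge> 3" "u < 2 * N" "v < 2 * N" "cycle_label N u = cycle_label N v"
  shows "u = v"
  using assms(2)
proof (cases rule: nat_less_double_cases)
  case u: (even i)
  from assms(3) show ?thesis
  proof (cases rule: nat_less_double_cases)
    case v: (even j)
    with u assms show ?thesis by (simp add: cycle_label_even)
  next
    case v: (odd j)
    with u assms show ?thesis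
      by (auto simp: cycle_label_even cycle_label_odd mod_Suc split: if_splits)
  qed
next
  case u: (odd i)
  from assms(3) show ?thesis
  proof (cases rule: nat_less_double_cases)
    case v: (even j)
    with u assms show ?thesis
      by (auto simp: cycle_label_even cycle_label_odd mod_Suc split: if_splits)
  next
    case v: (odd j)
    with u assms show ?thesis
      by (auto simp: cycle_label_odd mod_Suc doubleton_eq_iff split: if_splits)
  qed
qed

lemma cycle_label_comparable_iff:
  assumes N: "N \<ge> 3" and "u < 2 * N" "v < 2 * N"
  shows "cycle_label N u \<subset> cycle_label N v \<or> cycle_label N v \<subset> cycle_label N u \<longleftrightarrow>
    v = Suc u mod (2 * N) \<or> u = Suc v mod (2 * N)"
proof -
  have succ_even: "Suc (2 * i) mod (2 * N) = Suc (2 * i)" if "i < N" for i using that by simp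
  have succ_odd: "Suc (Suc (2 * i)) mod (2 * N) = 2 * (Suc i mod N)" for i
    by (simp add: mult_mod_right)
  have next_neq: "Suc i mod N \<noteq> i" "i \<noteq> Suc i mod N" if "i < N" for i
    using that N by (auto simp: mod_Suc)
  have parity: "Suc (2 * i) \<noteq> 2 * j" "2 * j \<noteq> Suc (2 * i)" for i j :: nat by presburger+
  show ?thesis using \<open>u < 2 * N\<close>
  proof (cases rule: nat_less_double_cases)
    case u: (even i)
    from \<open>v < 2 * N\<close> show ?thesis
    proof (cases rule: nat_less_double_cases)
      case v: (even j)
      show ?thesis unfolding u(2) v(2) succ_even[OF u(1)] succ_even[OF v(1)]
        by (simp add: u(1) v(1) cycle_label_even parity psubset_eq)
    next
      case v: (odd j)
      show ?thesis unfolding u(2) v(2) succ_even[OF u(1)] succ_odd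
        using next_neq[OF v(1)] by (auto simp: u(1) cycle_label_even cycle_label_odd psubset_eq)
    qed
  next
    case u: (odd i)
    from \<open>v < 2 * N\<close> show ?thesis
    proof (cases rule: nat_less_double_cases)
      case v: (even j)
      show ?thesis unfolding u(2) v(2) succ_even[OF v(1)] succ_odd
        using next_neq[OF u(1)] by (auto simp: v(1) cycle_label_even cycle_label_odd psubset_eq)
    next
      case v: (odd j)
      show ?thesis unfolding u(2) v(2) succ_odd cycle_label_odd
        using next_neq[OF u(1)] next_neq[OF v(1)] parity by (auto simp: psubset_eq)
    qed
  qed
qed

lemma (in group) nat_pow_eq_self:
  assumes "x \<in> carrier G" "x [^] (m::nat) = \<one>" "n = m * a + 1"
  shows "x [^] n = x"
  using assms by (simp flip: nat_pow_pow)

lemma (in group) nat_pow_eq_one: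
  assumes "x \<in> carrier G" "x [^] (m::nat) = \<one>"
  shows "x [^] (m * a) = \<one>"
  using assms by (simp flip: nat_pow_pow)

lemma power_graph_edge_iff:
  "{a, b} \<in> snd (power_graph G) \<longleftrightarrow>
     a \<in> carrier G \<and> b \<in> carrier G \<and> a \<noteq> b \<and>
     ((\<exists>t::nat>0. a = b [^]\<^bsub>G\<^esub> t) \<or> (\<exists>t::nat>0. b = a [^]\<^bsub>G\<^esub> t))"
proof -
  define Q where "Q a b \<longleftrightarrow> (\<exists>t::nat>0. a = b [^]\<^bsub>G\<^esub> t)" for a b
  show ?thesis
    unfolding power_graph_def snd_conv mem_Collect_eq doubleton_eq_iff Q_def[symmetric] by blast
qed

text \<open>
  As \<open>m\<close> and \<open>k\<close> are coprime, there is an exponent that fixes the elements of order dividing \<open>m\<close>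
  and kills those of order dividing \<open>k\<close>, and another one with the roles exchanged. These two powers
  recover the factors of every vertex from the vertex. Hence a vertex is a power of another one iff
  its factors are among those of the other, and adjacency is comparability of the labels.
\<close>

lemma (in group) induced_cycle_power_graph:
  fixes w :: "nat \<Rightarrow> 'a" and m k N :: nat
  assumes N: "even N" "N \<ge> 4" and mk: "coprime m k" "m > 0" "k > 0"
    and closed: "\<And>i. i < N \<Longrightarrow> w i \<in> carrier G"
    and pow_m: "\<And>i. i < N \<Longrightarrow> even i \<Longrightarrow> w i [^] m = \<one>"
    and pow_k: "\<And>i. i < N \<Longrightarrow> odd i \<Longrightarrow> w i [^] k = \<one>"
    and comm: "\<And>i. i < N \<Longrightarrow> w i \<otimes> w (Suc i mod N) = w (Suc i mod N) \<otimes> w i"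
    and no_pow: "\<And>i j (t::nat). i < N \<Longrightarrow> j < N \<Longrightarrow> i \<noteq> j \<Longrightarrow> even i = even j \<Longrightarrow> w i \<noteq> w j [^] t"
  shows "induced_cycle (power_graph G) (2 * N)
    (\<lambda>v. if even v then w (v div 2) else w (v div 2) \<otimes> w (Suc (v div 2) mod N))"
proof -
  define c where
    "c = (\<lambda>v. if even v then w (v div 2) else w (v div 2) \<otimes> w (Suc (v div 2) mod N))"
  let ?L = "cycle_label N"
  have c_even: "c (2 * i) = w i" for i by (simp add: c_def)
  have c_odd: "c (Suc (2 * i)) = w i \<otimes> w (Suc i mod N)" for i by (simp add: c_def)
  obtain a b where ab: "k * b = m * a + 1" 
    using bezout_nat[of k m] mk by (auto simp: coprime_iff_gcd_eq_1 gcd.commute)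
  obtain a' b' where ab': "m * b' = k * a' + 1" 
    using bezout_nat[of m k] mk by (auto simp: coprime_iff_gcd_eq_1)
  \<comment> \<open>\<open>e True\<close> projects to the factors of even index, \<open>e False\<close> to those of odd index.\<close>
  define e where "e p = (if p then k * b else m * b')" for p
  have e_pos: "e p > 0" for p using ab ab' by (simp add: e_def)
  have w_proj: "w i [^] e p = (if even i = p then w i else \<one>)" if "i < N" for i p
  proof (cases p)
    case True
    then show ?thesis
      using that closed pow_m pow_k nat_pow_eq_self[OF _ _ ab] nat_pow_eq_one[of "w i" k b]
      by (simp add: e_def)
  next
    case False
    then show ?thesis
      using that closed pow_m pow_k nat_pow_eq_self[OF _ _ ab'] nat_pow_eq_one[of "w i" m b']
      by (simp add: e_def)
  qed
  have parity: "even (Suc i mod N) \<longleftrightarrow> odd i" "Suc i mod N < N" for i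
    using N by (auto simp: dvd_mod_iff)
  have c_closed: "c v \<in> carrier G" if "v < 2 * N" for v
    using that by (cases rule: nat_less_double_cases) (simp_all add: c_even c_odd closed parity)
  have c_proj_in: "c v [^] e (even i) = w i" if "v < 2 * N" "i \<in> ?L v" for v i
    using that(1)
  proof (cases rule: nat_less_double_cases)
    case (even j)
    with that show ?thesis by (simp add: cycle_label_even c_even w_proj)
  next
    case (odd j)
    with that show ?thesis
      by (auto simp: cycle_label_odd c_odd pow_mult_distrib comm closed parity w_proj)
  qed
  have c_proj_out: "c v [^] e p = \<one>" if "v < 2 * N" "\<And>i. i \<in> ?L v \<Longrightarrow> even i \<noteq> p" for v p
    using that(1)
  proof (cases rule: nat_less_double_cases)
    case (even j)
    with that show ?thesis by (simp add: cycle_label_even c_even w_proj)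
  next
    case (odd j)
    with that(2)[of j] that(2)[of "Suc j mod N"] parity[of j] show ?thesis
      by (auto simp: cycle_label_odd)
  qed
  have L_less: "i < N" if "v < 2 * N" "i \<in> ?L v" for i v
    using that by (auto simp: cycle_label_def)
  have w_nontrivial: "w i \<noteq> \<one>" if "i < N" for i
  proof -
    \<comment> \<open>The identity would be the zeroth power of any other element of the same parity.\<close>
    define j where "j = (if i < 2 then i + 2 else i - 2)"
    have "j < N" "i \<noteq> j" "even i = even j" using that N by (auto simp: j_def)
    from no_pow[OF that this, of 0] show ?thesis by simp
  qed
  have w_not_pow: "w i \<noteq> c v [^] t" if v: "v < 2 * N" and i: "i < N" "i \<notin> ?L v" for i v and t :: nat
  proof
    assume eq: "w i = c v [^] t"
    have "w i = w i [^] e (even i)" using i by (simp add: w_proj)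
    also have "\<dots> = (c v [^] e (even i)) [^] t"
      using nat_pow_pow[OF c_closed[OF v]] by (simp add: eq mult.commute)
    finally have *: "w i = (c v [^] e (even i)) [^] t" .
    show False
    proof (cases "\<exists>j\<in>?L v. even j = even i")
      case True
      then obtain j where j: "j \<in> ?L v" "even j = even i" by blast
      with * c_proj_in[OF v j(1)] have "w i = w j [^] t" by simp
      with no_pow[OF i(1) L_less[OF v j(1)]] i j show False by metis
    next
      case False
      with c_proj_out[OF v, of "even i"] * w_nontrivial[OF i(1)] show False by auto
    qed
  qed
  have pow_iff: "(\<exists>t::nat>0. c u = c v [^] t) \<longleftrightarrow> ?L u \<subseteq> ?L v" if u: "u < 2 * N" and v: "v < 2 * N" for u v
  proof
    assume "\<exists>t::nat>0. c u = c v [^] t"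
    then obtain t :: nat where t: "c u = c v [^] t" by blast
    show "?L u \<subseteq> ?L v"
    proof
      fix i assume i: "i \<in> ?L u"
      have "w i = c v [^] (t * e (even i))"
        using c_proj_in[OF u i] by (simp add: t nat_pow_pow c_closed v)
      with w_not_pow[OF v L_less[OF u i]] show "i \<in> ?L v" by blast
    qed
  next
    assume sub: "?L u \<subseteq> ?L v"
    from u show "\<exists>t::nat>0. c u = c v [^] t"
    proof (cases rule: nat_less_double_cases)
      case (even i)
      then have "c u = c v [^] e (even i)"
        using sub c_proj_in[OF v, of i] by (simp add: c_even cycle_label_even)
      with e_pos show ?thesis by blast
    next
      case (odd i)
      then have "c v [^] e (even i) = w i" "c v [^] e (even (Suc i mod N)) = w (Suc i mod N)"
        using sub by (auto intro!: c_proj_in[OF v] simp: cycle_label_odd)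
      then have "c u = c v [^] (e (even i) + e (even (Suc i mod N)))"
        using odd by (simp add: c_odd c_closed v flip: nat_pow_mult)
      with e_pos show ?thesis by (meson add_pos_pos)
    qed
  qed
  have c_eq_iff: "c u = c v \<longleftrightarrow> u = v" if u: "u < 2 * N" and v: "v < 2 * N" for u v
  proof
    assume "c u = c v"
    then have "c u = c v [^] (1::nat)" "c v = c u [^] (1::nat)" using c_closed u v by auto
    then have "?L u = ?L v" using pow_iff u v by (metis subset_antisym zero_less_one)
    then show "u = v" using cycle_label_inj[of N u v] u v N by auto
  qed simp
  have "{c u, c v} \<in> snd (power_graph G) \<longleftrightarrow> v = Suc u mod (2 * N) \<or> u = Suc v mod (2 * N)"
    if u: "u < 2 * N" and v: "v < 2 * N" for u v
  proof -
    have "{c u, c v} \<in> snd (power_graph G) \<longleftrightarrow>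
        c u \<noteq> c v \<and> ((\<exists>t::nat>0. c u = c v [^] t) \<or> (\<exists>t::nat>0. c v = c u [^] t))"
      using c_closed[OF u] c_closed[OF v] by (simp only: power_graph_edge_iff simp_thms)
    also have "\<dots> \<longleftrightarrow> ?L u \<noteq> ?L v \<and> (?L u \<subseteq> ?L v \<or> ?L v \<subseteq> ?L u)"
      using cycle_label_inj[of N u v] N u v by (auto simp: pow_iff c_eq_iff)
    also have "\<dots> \<longleftrightarrow> ?L u \<subset> ?L v \<or> ?L v \<subset> ?L u" by blast
    finally show ?thesis using cycle_label_comparable_iff[of N u v] N u v by simp
  qed
  then have "induced_cycle (power_graph G) (2 * N) c"
    using c_eq_iff c_closed by (auto simp: induced_cycle_def inj_on_def power_graph_def)
  then show ?thesis by (simp only: c_def)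
qed

text \<open>
  The identities \<open>w\<^sub>i\<^sup>m = 1\<close>, \<open>w\<^sub>i\<^sup>k = 1\<close> and commutation pass to the quotient. If \<open>g\<close> is a power of \<open>h\<close> in the quotient, then
  \<open>g = z h\<^sup>t\<close> with \<open>z\<close> central, so \<open>g\<close> and \<open>h\<close> commute already in \<open>G\<close>.
\<close>

lemma (in group) not_chordal_Mod_centre:
  fixes w :: "nat \<Rightarrow> 'a" and m k N :: nat
  assumes N: "even N" "N \<ge> 4" and mk: "coprime m k" "m > 0" "k > 0"
    and closed: "\<And>i. i < N \<Longrightarrow> w i \<in> carrier G"
    and pow_m: "\<And>i. i < N \<Longrightarrow> even i \<Longrightarrow> w i [^] m = \<one>"
    and pow_k: "\<And>i. i < N \<Longrightarrow> odd i \<Longrightarrow> w i [^] k = \<one>"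
    and comm: "\<And>i. i < N \<Longrightarrow> w i \<otimes> w (Suc i mod N) = w (Suc i mod N) \<otimes> w i"
    and noncomm: "\<And>i j. i < N \<Longrightarrow> j < N \<Longrightarrow> i \<noteq> j \<Longrightarrow> even i = even j \<Longrightarrow> w i \<otimes> w j \<noteq> w j \<otimes> w i"
  shows "\<not> chordal (power_graph (G Mod group_centre G))"
proof -
  let ?Z = "group_centre G"
  interpret normal ?Z G by (rule group_centre_normal)
  interpret Q: group "G Mod ?Z" by (rule factorgroup_is_group)
  define \<pi> where "\<pi> g = ?Z #> g" for g
  have \<pi>_hom: "\<pi> \<in> hom G (G Mod ?Z)" unfolding \<pi>_def by (rule r_coset_hom_Mod)
  interpret \<pi>: group_hom G "G Mod ?Z" \<pi>
    by (intro group_hom.intro group_hom_axioms.intro \<pi>_hom Q.group_axioms group_axioms)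
  have eq_imp: "g \<otimes> h = h \<otimes> g" 
    if "\<pi> g = \<pi> (h [^] t)" "g \<in> carrier G" "h \<in> carrier G" for g h and t :: nat
  proof -
    have "g \<in> ?Z #> h [^] t" using that rcos_self[of g ?Z] subgroup_axioms by (simp add: \<pi>_def)
    then obtain z where z: "z \<in> ?Z" "g = z \<otimes> h [^] t" by (auto simp: r_coset_def)
    have zc: "z \<in> carrier G" "z \<otimes> h = h \<otimes> z" using z(1) that(3) unfolding group_centre_def by blast+
    have "h [^] t \<otimes> h = h \<otimes> h [^] t" using nat_pow_comm[of h t 1] that(3) by simp
    then have "g \<otimes> h = z \<otimes> (h \<otimes> h [^] t)" using zc that(3) by (simp add: z(2) m_assoc)
    also have "\<dots> = h \<otimes> g" using zc that(3) by (simp add: z(2) flip: m_assoc)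
    finally show ?thesis .
  qed
  have "induced_cycle (power_graph (G Mod ?Z)) (2 * N)
     (\<lambda>v. if even v then \<pi> (w (v div 2))
          else \<pi> (w (v div 2)) \<otimes>\<^bsub>G Mod ?Z\<^esub> \<pi> (w (Suc (v div 2) mod N)))"
  proof (rule Q.induced_cycle_power_graph[of N m k "\<lambda>i. \<pi> (w i)"])
    show "\<pi> (w i) \<in> carrier (G Mod ?Z)" if "i < N" for i using closed that by simp
    show "\<pi> (w i) [^]\<^bsub>G Mod ?Z\<^esub> m = \<one>\<^bsub>G Mod ?Z\<^esub>" if "i < N" "even i" for i
      using \<pi>.hom_nat_pow[of "w i" m] pow_m closed that by simp
    show "\<pi> (w i) [^]\<^bsub>G Mod ?Z\<^esub> k = \<one>\<^bsub>G Mod ?Z\<^esub>" if "i < N" "odd i" for i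
      using \<pi>.hom_nat_pow[of "w i" k] pow_k closed that by simp
    show "\<pi> (w i) \<otimes>\<^bsub>G Mod ?Z\<^esub> \<pi> (w (Suc i mod N)) = \<pi> (w (Suc i mod N)) \<otimes>\<^bsub>G Mod ?Z\<^esub> \<pi> (w i)"
      if "i < N" for i
    proof -
      have "Suc i mod N < N" using that by simp
      with comm[OF that] closed that show ?thesis by (metis \<pi>.hom_mult)
    qed
    show "\<pi> (w i) \<noteq> \<pi> (w j) [^]\<^bsub>G Mod ?Z\<^esub> t"
      if "i < N" "j < N" "i \<noteq> j" "even i = even j" for i j and t :: nat
      using noncomm[OF that] eq_imp[of "w i" "w j" t] closed that(1,2) by (auto simp: \<pi>.hom_nat_pow)
  qed (use N mk in auto)
  then show ?thesis using N by (auto simp: chordal_def intro!: exI[of _ "2 * N"])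
qed

section \<open>Odd characteristic\<close>

text \<open>
  The form pairs the first basis vector with the third and the second with the fourth. The two
  hyperbolic planes that they span are orthogonal, and this matrix acts on them by
  \<open>a b c d\<close> and by \<open>a' b' c' d'\<close> (row by row) respectively.
\<close>

definition sl2_pair :: "'a::field \<Rightarrow> 'a \<Rightarrow> 'a \<Rightarrow> 'a \<Rightarrow> 'a \<Rightarrow> 'a \<Rightarrow> 'a \<Rightarrow> 'a \<Rightarrow> 'a ^ 4 ^ 4" where
  "sl2_pair a b c d a' b' c' d' = vector
     [vector [a,  0, b,  0],
      vector [0, a', 0, b'],
      vector [c,  0, d,  0],
      vector [0, c', 0, d']]"

lemma vector_4_nth:
  "(vector [a, b, c, d] :: 'a::zero ^ 4) $ 1 = a"
  "(vector [a, b, c, d] :: 'a::zero ^ 4) $ 2 = b"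
  "(vector [a, b, c, d] :: 'a::zero ^ 4) $ 3 = c"
  "(vector [a, b, c, d] :: 'a::zero ^ 4) $ 4 = d"
  by (simp_all add: vector_def)

lemmas matrix4_simps =
  vec_eq_iff forall_4 matrix_matrix_mult_def transpose_def mat_def sum_4 sympl_form_def vector_4_nth

lemma sl2_pair_mult:
  "sl2_pair a b c d a' b' c' d' ** sl2_pair e f g h e' f' g' h' =
   sl2_pair (a*e + b*g) (a*f + b*h) (c*e + d*g) (c*f + d*h)
            (a'*e' + b'*g') (a'*f' + b'*h') (c'*e' + d'*g') (c'*f' + d'*h')"
  by (simp add: sl2_pair_def matrix4_simps)

lemma sl2_pair_in_Sp4:
  "a * d - b * c = 1 \<Longrightarrow> a' * d' - b' * c' = 1 \<Longrightarrow> sl2_pair a b c d a' b' c' d' \<in> carrier Sp4"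
  by (simp add: Sp4_def sl2_pair_def matrix4_simps algebra_simps)

lemma sl2_pair_one: "mat 1 = sl2_pair 1 0 0 1 1 0 0 1"
  by (simp add: sl2_pair_def matrix4_simps)

lemma sl2_pair_eq_iff:
  "sl2_pair a b c d a' b' c' d' = sl2_pair e f g h e' f' g' h' \<longleftrightarrow>
   a = e \<and> b = f \<and> c = g \<and> d = h \<and> a' = e' \<and> b' = f' \<and> c' = g' \<and> d' = h'"
  by (auto simp: sl2_pair_def matrix4_simps)

lemma Sp4_simps [simp]: "x \<otimes>\<^bsub>Sp4\<^esub> y = x ** y" "\<one>\<^bsub>Sp4\<^esub> = mat 1"
  by (simp_all add: Sp4_def)

lemma unipotent_pow:
  "sl2_pair 1 0 0 1 1 b 0 1 [^]\<^bsub>Sp4\<^esub> (n::nat) = sl2_pair 1 0 0 1 1 (of_nat n * b) 0 1"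
  "sl2_pair 1 0 0 1 1 0 b 1 [^]\<^bsub>Sp4\<^esub> (n::nat) = sl2_pair 1 0 0 1 1 0 (of_nat n * b) 1"
  by (induction n) (simp_all add: sl2_pair_mult sl2_pair_one algebra_simps nat_pow_def)


text \<open>
  An involution of \<open>SL(2, q)\<close> with \<open>q\<close> odd is \<open>-1\<close>, so the even-indexed elements cannot have order
  two. They are taken of determinant one and trace zero, so that their square is \<open>-1\<close> by the
  Cayley-Hamilton theorem and their order is four, which is coprime to the characteristic.
\<close>

lemma not_chordal_PSp4_odd_char:
  assumes "(2 :: 'a::{field, finite}) \<noteq> 0"
  shows "\<not> chordal (power_graph (PSp4 :: ('a ^ 4 ^ 4) set monoid))"
proof -
  interpret group "Sp4 :: ('a ^ 4 ^ 4) monoid" by (rule group_Sp4)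
  define w :: "nat \<Rightarrow> 'a ^ 4 ^ 4" where "w = (!)
    [sl2_pair 0 1 (-1) 0 1 0 0 1,
     sl2_pair 1 0 0 1 1 1 0 1,
     sl2_pair 1 1 (-2) (-1) 1 0 0 1,
     sl2_pair 1 0 0 1 1 0 1 1]"
  have odd_char: "odd CHAR('a)"
  proof
    assume "even CHAR('a)"
    moreover have "prime CHAR('a)" by (simp add: prime_CHAR_semidom finite_imp_CHAR_pos)
    ultimately have "CHAR('a) = 2" using primes_dvd_imp_eq[OF two_is_prime_nat] by simp
    then have "of_nat 2 = (0 :: 'a)" using of_nat_CHAR[where 'a = 'a] by (simp only:)
    with assms show False by simp
  qed
  have two_neq_one: "(2 :: 'a) \<noteq> 1" "1 \<noteq> (2 :: 'a)"
    by (metis add_cancel_right_left one_add_one zero_neq_one)+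
  have less_4: "i = 0 \<or> i = 1 \<or> i = 2 \<or> i = 3" if "i < 4" for i :: nat using that by linarith
  show ?thesis unfolding PSp4_def
  proof (rule not_chordal_Mod_centre[of 4 4 "CHAR('a)" w])
    show "coprime 4 (CHAR('a))" using odd_char coprime_power_left_iff[of 2 2 "CHAR('a)"] by simp
    show "CHAR('a) > 0" by (simp add: finite_imp_CHAR_pos)
    fix i :: nat assume i: "i < 4"
    show "w i \<in> carrier Sp4" using less_4[OF i] by (auto simp: w_def sl2_pair_in_Sp4)
    show "w i \<otimes>\<^bsub>Sp4\<^esub> w (Suc i mod 4) = w (Suc i mod 4) \<otimes>\<^bsub>Sp4\<^esub> w i"
      using less_4[OF i] by (auto simp: w_def sl2_pair_mult)
    show "w i [^]\<^bsub>Sp4\<^esub> (4::nat) = \<one>\<^bsub>Sp4\<^esub>" if "even i"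
    proof -
      have "i = 0 \<or> i = 2" using less_4[OF i] that by auto
      then have "w i ** w i = sl2_pair (-1) 0 0 (-1) 1 0 0 1" by (auto simp: w_def sl2_pair_mult)
      moreover have "w i [^]\<^bsub>Sp4\<^esub> (4::nat) = (w i ** w i) ** (w i ** w i)"
        by (simp add: numeral_eq_Suc matrix_mul_assoc)
      ultimately show ?thesis by (simp add: sl2_pair_mult sl2_pair_one)
    qed
    show "w i [^]\<^bsub>Sp4\<^esub> CHAR('a) = \<one>\<^bsub>Sp4\<^esub>" if "odd i"
      using less_4[OF i] that by (auto simp: w_def unipotent_pow sl2_pair_one)
    fix j :: nat assume j: "j < 4" and "i \<noteq> j" "even i = even j"
    then show "w i \<otimes>\<^bsub>Sp4\<^esub> w j \<noteq> w j \<otimes>\<^bsub>Sp4\<^esub> w i"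
      using less_4[OF i] less_4[OF j] assms two_neq_one by (auto simp: w_def sl2_pair_mult sl2_pair_eq_iff)
  qed simp_all
qed

section \<open>Characteristic two\<close>

text \<open>
  Let \<open>e\<^sub>1, e\<^sub>2, f\<^sub>1, f\<^sub>2\<close> be the standard basis, with \<open>e\<^sub>i\<close> paired with \<open>f\<^sub>i\<close>. The elements
  \<open>t0, t1, t2\<close> are the transvections \<open>v \<mapsto> v + \<langle>v, u\<rangle> u\<close> along \<open>u = e\<^sub>1, f\<^sub>1, e\<^sub>1 + f\<^sub>1 + e\<^sub>2\<close>; these
  vectors are pairwise not orthogonal, so that the transvections do not commute. Two of these
  vectors span a hyperbolic plane, and so does the orthogonal complement of that plane; an element
  of order three of the \<open>SL(2, 2)\<close> acting on the complement commutes with both transvections.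
  It is the product of two transvections: along \<open>e\<^sub>2\<close> and \<open>f\<^sub>2\<close> for \<open>y0\<close>, along \<open>e\<^sub>2\<close> and \<open>f\<^sub>1 + f\<^sub>2\<close>
  for \<open>y1\<close>, and along \<open>e\<^sub>2\<close> and \<open>e\<^sub>1 + f\<^sub>2\<close> for \<open>y2\<close>.
\<close>

lemma not_chordal_PSp4_char_2:
  assumes "(2 :: 'a::{field, finite}) = 0"
  shows "\<not> chordal (power_graph (PSp4 :: ('a ^ 4 ^ 4) set monoid))"
proof -
  interpret group "Sp4 :: ('a ^ 4 ^ 4) monoid" by (rule group_Sp4)
  define t0 :: "'a ^ 4 ^ 4" where
    "t0 = vector [vector [1,0,1,0], vector [0,1,0,0], vector [0,0,1,0], vector [0,0,0,1]]"
  define t1 :: "'a ^ 4 ^ 4" where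
    "t1 = vector [vector [1,0,0,0], vector [0,1,0,0], vector [1,0,1,0], vector [0,0,0,1]]"
  define t2 :: "'a ^ 4 ^ 4" where
    "t2 = vector [vector [0,0,1,1], vector [1,1,1,1], vector [1,0,0,1], vector [0,0,0,1]]"
  define y0 :: "'a ^ 4 ^ 4" where
    "y0 = vector [vector [1,0,0,0], vector [0,0,0,1], vector [0,0,1,0], vector [0,1,0,1]]"
  define y1 :: "'a ^ 4 ^ 4" where
    "y1 = vector [vector [1,0,0,0], vector [1,0,0,1], vector [1,1,1,0], vector [1,1,0,1]]"
  define y2 :: "'a ^ 4 ^ 4" where
    "y2 = vector [vector [1,1,1,0], vector [0,0,1,1], vector [0,0,1,0], vector [0,1,1,1]]"
  have "3 = 2 + (1::'a)" "4 = 2 + (2::'a)" "- 1 = 1 - (2::'a)" by simp_all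
  then have char_2: "2 = (0::'a)" "3 = (1::'a)" "4 = (0::'a)" "- 1 = (1::'a)"
    using assms by (simp_all only: add_0_left add_0_right diff_0_right)
  note entries = t0_def t1_def t2_def y0_def y1_def y2_def matrix4_simps char_2
  have in_Sp4: "t0 \<in> carrier Sp4" "t1 \<in> carrier Sp4" "t2 \<in> carrier Sp4"
      "y0 \<in> carrier Sp4" "y1 \<in> carrier Sp4" "y2 \<in> carrier Sp4"
    by (simp_all add: Sp4_def entries)
  have squares: "t0 ** t0 = mat 1" "t1 ** t1 = mat 1" "t2 ** t2 = mat 1"
    by (simp_all add: entries)
  have cubes: "y0 ** y0 ** y0 = mat 1" "y1 ** y1 ** y1 = mat 1" "y2 ** y2 ** y2 = mat 1"
    by (simp_all add: entries)
  have commute: "t0 ** y0 = y0 ** t0" "t1 ** y0 = y0 ** t1" "t1 ** y1 = y1 ** t1"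
      "t2 ** y1 = y1 ** t2" "t2 ** y2 = y2 ** t2" "t0 ** y2 = y2 ** t0"
    by (simp_all add: entries)
  have t_noncomm: "t0 ** t1 \<noteq> t1 ** t0" "t0 ** t2 \<noteq> t2 ** t0" "t1 ** t2 \<noteq> t2 ** t1"
    by (simp_all add: entries)
  have y_noncomm: "y0 ** y1 \<noteq> y1 ** y0" "y0 ** y2 \<noteq> y2 ** y0" "y1 ** y2 \<noteq> y2 ** y1"
    by (simp_all add: entries)
  define w where "w = (!) [t0, y0, t1, y1, t2, y2]"
  have w: "w 0 = t0" "w 1 = y0" "w 2 = t1" "w 3 = y1" "w 4 = t2" "w 5 = y2"
    by (simp_all add: w_def)
  have less_6: "i = 0 \<or> i = 1 \<or> i = 2 \<or> i = 3 \<or> i = 4 \<or> i = 5" if "i < 6" for i :: nat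
    using that by linarith
  show ?thesis unfolding PSp4_def
  proof (rule not_chordal_Mod_centre[of 6 2 3 w])
    fix i :: nat assume i: "i < 6"
    show "w i \<in> carrier Sp4" using less_6[OF i] w in_Sp4 by metis
    show "w i \<otimes>\<^bsub>Sp4\<^esub> w (Suc i mod 6) = w (Suc i mod 6) \<otimes>\<^bsub>Sp4\<^esub> w i"
      using less_6[OF i] by (auto simp: w_def commute)
    show "w i [^]\<^bsub>Sp4\<^esub> (2::nat) = \<one>\<^bsub>Sp4\<^esub>" if "even i"
    proof -
      have "i = 0 \<or> i = 2 \<or> i = 4" using less_6[OF i] that by auto
      then have "w i ** w i = mat 1" using w squares by metis
      then show ?thesis by (simp add: numeral_2_eq_2)
    qed
    show "w i [^]\<^bsub>Sp4\<^esub> (3::nat) = \<one>\<^bsub>Sp4\<^esub>" if "odd i"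
    proof -
      have "i = 1 \<or> i = 3 \<or> i = 5" using less_6[OF i] that by auto
      then have "w i ** w i ** w i = mat 1" using w cubes by metis
      then show ?thesis by (simp add: numeral_3_eq_3)
    qed
    fix j :: nat assume j: "j < 6" and "i \<noteq> j" "even i = even j"
    then show "w i \<otimes>\<^bsub>Sp4\<^esub> w j \<noteq> w j \<otimes>\<^bsub>Sp4\<^esub> w i"
      using less_6[OF i] less_6[OF j] t_noncomm y_noncomm by (auto simp: w_def)
  qed (simp_all add: coprime_left_2_iff_odd)
qed

section \<open>The power graph of the projective symplectic group\<close>

theorem theorem5p10:
  fixes q :: nat
  assumes "primepow q"
    and "CARD('a::{field, finite}) = q"
  shows "\<not> chordal (power_graph (PSp4 :: ('a ^ 4 ^ 4) set monoid))"
  using not_chordal_PSp4_odd_char not_chordal_PSp4_char_2 by (cases "(2::'a) = 0")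

end
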